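(* Let $G=Z_n$ be a cyclic group of order $n$, and let $\mathcal{H}\le\mathrm{Aut}(G)$. Then, as $\mathbb{Q}$-algebras, $$\mathbb{Q}[G]^{\mathcal{H}}\cong\bigoplus_{d\mid n}\mathbb{Q}(\zeta_d)^{\mathcal{H}}.$$
   Context: $\zeta_d=e^{2\pi i/d}$. Each automorphism of $Z_n$ has the form $z\mapsto z^m$ for a unique class $m$ in $(\mathbb{Z}/n\mathbb{Z})^\times$, so $\mathrm{Aut}(Z_n)$ is identified with $(\mathbb{Z}/n\mathbb{Z})^\times$. $\mathcal{H}$ acts on $\mathbb{Q}[G]$ by linear extension, and $\mathbb{Q}[G]^{\mathcal{H}}=\{\alpha\in\mathbb{Q}[G]\mid\sigma(\alpha)=\alpha\text{ for all }\sigma\in\mathcal{H}\}$. For $d\mid n$, $\mathcal{H}$ acts on $\mathbb{Q}(\zeta_d)$ by reduction modulo $d$: the element of $\mathcal{H}$ corresponding to $m$ acts as the field automorphism with $\zeta_d\mapsto\zeta_d^m$. $\mathbb{Q}(\zeta_d)^{\mathcal{H}}$ is the fixed subfield of this action. *)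

theory Defs
  imports
    "HOL-Algebra.Algebra"
    "HOL-Algebra.Algebraic_Closure_Type"
    "HOL-Library.Poly_Mapping"
    Complex_Main
begin

section \<open>Algebras over a ring of scalars\<close>

definition algebra_iso ::
  "('r, 'm) ring_scheme \<Rightarrow> ('r, 'a, 'k) module_scheme \<Rightarrow> ('r, 'b, 'l) module_scheme
    \<Rightarrow> ('a \<Rightarrow> 'b) set"
  where "algebra_iso R A B =
    {h \<in> ring_iso A B.
      \<forall>r \<in> carrier R. \<forall>x \<in> carrier A. h (r \<odot>\<^bsub>A\<^esub> x) = r \<odot>\<^bsub>B\<^esub> h x}"

definition algebra_isomorphic ::
  "('r, 'm) ring_scheme \<Rightarrow> ('r, 'a, 'k) module_scheme \<Rightarrow> ('r, 'b, 'l) module_scheme \<Rightarrow> bool"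
  where "algebra_isomorphic R A B \<longleftrightarrow> algebra_iso R A B \<noteq> {}"

text \<open>The underlying set is the full Cartesian product, so this is the direct sum only for
  a finite index set.\<close>

definition direct_sum_algebra ::
  "'i set \<Rightarrow> ('i \<Rightarrow> ('r, 'a, 'k) module_scheme) \<Rightarrow> ('r, 'i \<Rightarrow> 'a) module"
  where "direct_sum_algebra I A =
    \<lparr>carrier = (\<Pi>\<^sub>E i\<in>I. carrier (A i)),
     monoid.mult = (\<lambda>x y. \<lambda>i\<in>I. x i \<otimes>\<^bsub>A i\<^esub> y i),
     monoid.one = (\<lambda>i\<in>I. \<one>\<^bsub>A i\<^esub>),
     ring.zero = (\<lambda>i\<in>I. \<zero>\<^bsub>A i\<^esub>),
     ring.add = (\<lambda>x y. \<lambda>i\<in>I. x i \<oplus>\<^bsub>A i\<^esub> y i),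
     module.smult = (\<lambda>r x. \<lambda>i\<in>I. r \<odot>\<^bsub>A i\<^esub> x i)\<rparr>"

abbreviation rat_field :: "rat ring"
  where "rat_field \<equiv> ring_of_type_algebra"


section \<open>The rational group algebra and the action of automorphisms\<close>

text \<open>The element \<open>\<Sum>x. a\<^sub>x x\<close> is the finitely supported map \<open>x \<mapsto> a\<^sub>x\<close>;
  the basis element \<open>x\<close> is \<open>Poly_Mapping.single x 1\<close>. The product is the bilinear extension
  of the product of the group, not the multiplication of the type of finitely supported
  maps (which would use an additive monoid structure on the type of the group elements).\<close>

definition group_algebra :: "('a, 'b) monoid_scheme \<Rightarrow> (rat, 'a \<Rightarrow>\<^sub>0 rat) module"
  where "group_algebra G =
    \<lparr>carrier = {\<alpha>. Poly_Mapping.keys \<alpha> \<subseteq> carrier G},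
     monoid.mult = (\<lambda>\<alpha> \<beta>. \<Sum>x\<in>Poly_Mapping.keys \<alpha>. \<Sum>y\<in>Poly_Mapping.keys \<beta>.
       Poly_Mapping.single (x \<otimes>\<^bsub>G\<^esub> y) (Poly_Mapping.lookup \<alpha> x * Poly_Mapping.lookup \<beta> y)),
     monoid.one = Poly_Mapping.single \<one>\<^bsub>G\<^esub> 1,
     ring.zero = 0,
     ring.add = (+),
     module.smult = (\<lambda>q. Poly_Mapping.map ((*) q))\<rparr>"

definition linear_extension :: "('a \<Rightarrow> 'a) \<Rightarrow> ('a \<Rightarrow>\<^sub>0 rat) \<Rightarrow> ('a \<Rightarrow>\<^sub>0 rat)"
  where "linear_extension \<sigma> \<alpha> =
    (\<Sum>x\<in>Poly_Mapping.keys \<alpha>. Poly_Mapping.single (\<sigma> x) (Poly_Mapping.lookup \<alpha> x))"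

definition fixed_group_algebra ::
  "('a, 'b) monoid_scheme \<Rightarrow> ('a \<Rightarrow> 'a) set \<Rightarrow> (rat, 'a \<Rightarrow>\<^sub>0 rat) module"
  where "fixed_group_algebra G H =
    (group_algebra G)
      \<lparr>carrier := {\<alpha> \<in> carrier (group_algebra G). \<forall>\<sigma>\<in>H. linear_extension \<sigma> \<alpha> = \<alpha>}\<rparr>"


section \<open>Cyclotomic fields and the induced action\<close>

definition complex_algebra :: "(rat, complex) module"
  where "complex_algebra =
    \<lparr>carrier = UNIV, monoid.mult = (*), monoid.one = 1, ring.zero = 0, ring.add = (+),
     module.smult = (\<lambda>q z. of_rat q * z)\<rparr>"

definition zeta :: "nat \<Rightarrow> complex"
  where "zeta d = exp (2 * of_real pi * \<i> / of_nat d)"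

definition cyclotomic_field :: "nat \<Rightarrow> (rat, complex) module"
  where "cyclotomic_field d =
    complex_algebra \<lparr>carrier := generate_field complex_algebra (\<rat> \<union> {zeta d})\<rparr>"

text \<open>The field automorphism of \<open>\<rat>(\<zeta>\<^sub>d)\<close> with \<open>\<zeta>\<^sub>d \<mapsto> \<zeta>\<^sub>d\<^sup>m\<close>, for \<open>m\<close> coprime to \<open>d\<close>.
  It is unique as a map on \<open>\<rat>(\<zeta>\<^sub>d)\<close>; extensionality makes it unique as a HOL function.\<close>

definition cyclotomic_aut :: "nat \<Rightarrow> nat \<Rightarrow> complex \<Rightarrow> complex"
  where "cyclotomic_aut d m =
    (THE \<tau>. \<tau> \<in> ring_iso (cyclotomic_field d) (cyclotomic_field d)
      \<and> \<tau> \<in> extensional (carrier (cyclotomic_field d))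
      \<and> \<tau> (zeta d) = zeta d ^ m)"

text \<open>The class in \<open>(\<int>/n\<int>)\<^sup>\<times>\<close> of an automorphism \<open>z \<mapsto> z\<^sup>m\<close> of a cyclic group of finite
  order \<open>n\<close>, represented in \<open>{0..<n}\<close> (for \<open>n = 1\<close> this is \<open>m = 0\<close>).\<close>

definition aut_exponent :: "('a, 'b) monoid_scheme \<Rightarrow> ('a \<Rightarrow> 'a) \<Rightarrow> nat"
  where "aut_exponent G \<sigma> =
    (THE m. m < Coset.order G \<and> coprime m (Coset.order G) \<and> (\<forall>z\<in>carrier G. \<sigma> z = z [^]\<^bsub>G\<^esub> m))"

definition fixed_cyclotomic_field ::
  "('a, 'b) monoid_scheme \<Rightarrow> ('a \<Rightarrow> 'a) set \<Rightarrow> nat \<Rightarrow> (rat, complex) module"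
  where "fixed_cyclotomic_field G H d =
    (cyclotomic_field d)
      \<lparr>carrier := {x \<in> carrier (cyclotomic_field d).
        \<forall>\<sigma>\<in>H. cyclotomic_aut d (aut_exponent G \<sigma>) x = x}\<rparr>"

end

(* Send g^k to the tuple (zeta_d^k) over d | n, where g generates G. This map Q[G] -> prod Q(zeta_d)
   intertwines z |-> z^m with the automorphisms zeta_d |-> zeta_d^m, so once it is bijective it
   restricts to a bijection of the fixed subalgebras.

   Injectivity and the very existence of these automorphisms both rest on one fact: if a rational
   polynomial vanishes at z with z^d = 1, it vanishes at z^m for every m coprime to d. To see this,
   let f be an integer polynomial of least degree vanishing at z and q a prime. If f(y) = 0 for a
   power y of z, then f(y^q) is in q Z[z] by the Frobenius congruence; if also f(y^q) were nonzero,
   it would divide b d in Z[z], where b (X^d - 1) = f g. This is impossible unless q divides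
   b d or the leading coefficient of f, and m can be shifted modulo d to avoid these finitely many
   primes. Since powers of zeta_n exhaust all conjugates of the zeta_d, a kernel element is a
   polynomial of degree below n with n roots. Surjectivity is explicit interpolation. *)

theory Submission
  imports Defs "HOL-Number_Theory.Cong"
begin

section \<open>Conjugates of roots of unity over the rationals\<close>

locale coeff_hom =
  fixes h :: "'a::idom \<Rightarrow> 'b::idom"
  assumes hom_add: "h (x + y) = h x + h y"
    and hom_mult: "h (x * y) = h x * h y"
    and hom_one: "h 1 = 1"
begin

lemma hom_zero: "h 0 = 0"
  using hom_add[of 0 0] by (metis add_cancel_right_right add_0)

lemma hom_minus: "h (- x) = - h x"
  using hom_add[of x "-x"] by (simp add: hom_zero eq_neg_iff_add_eq_0 add.commute)

abbreviation ev :: "'a poly \<Rightarrow> 'b \<Rightarrow> 'b"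
  where "ev p z \<equiv> poly (map_poly h p) z"

lemma ev_pCons: "ev (pCons a p) z = h a + z * ev p z"
  by (simp add: map_poly_pCons hom_zero)

lemma ev_1: "ev 1 z = 1"
  by (simp add: hom_one)

lemma ev_const: "ev [:a:] z = h a"
  by (simp add: ev_pCons)

lemma ev_add: "ev (p + q) z = ev p z + ev q z"
  by (induction p q rule: poly_induct2) (simp_all add: ev_pCons hom_add algebra_simps)

lemma ev_smult: "ev (smult a p) z = h a * ev p z"
  by (induction p) (simp_all add: ev_pCons hom_mult algebra_simps)

lemma ev_minus: "ev (- p) z = - ev p z"
  by (induction p) (simp_all add: ev_pCons hom_minus algebra_simps)

lemma ev_diff: "ev (p - q) z = ev p z - ev q z"
  using ev_add[of p "-q"] by (simp add: ev_minus)

lemma ev_mult: "ev (p * q) z = ev p z * ev q z"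
  by (induction p) (simp_all add: ev_pCons ev_add ev_smult algebra_simps hom_zero)

lemma ev_power: "ev (p ^ k) z = ev p z ^ k"
  by (induction k) (simp_all add: ev_1 ev_mult hom_one)

lemma ev_monom: "ev (Polynomial.monom a k) z = h a * z ^ k"
  by (simp add: map_poly_monom hom_zero poly_monom)

lemma ev_pcompose: "ev (pcompose p q) z = ev p (ev q z)"
  by (induction p) (simp_all add: ev_pCons ev_add ev_mult pcompose_pCons)

lemma ev_sum: "ev (sum f S) z = (\<Sum>i\<in>S. ev (f i) z)"
  by (induction S rule: infinite_finite_induct) (simp_all add: ev_add)

lemma ev_prod: "ev (prod f S) z = (\<Prod>i\<in>S. ev (f i) z)"
  by (induction S rule: infinite_finite_induct) (simp_all add: ev_mult hom_one)

lemma ev_cyclo: "ev (Polynomial.monom 1 d - 1) z = z ^ d - 1"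
  by (simp add: ev_diff ev_monom ev_1 hom_one)

text \<open>Since the roots of unity are simple roots of \<open>X\<^sup>d - 1\<close>, differentiating a factorisation
  gives an explicit cofactor of \<open>p(z)\<close> in \<open>b d\<close> whenever the other factor vanishes at \<open>z\<close>.\<close>

lemma ev_cofactor:
  assumes "smult b (Polynomial.monom 1 d - 1) = p * q" and "ev q z = 0" and "z ^ d = 1" and "d > 0"
  shows "h b * h (of_nat d) = ev p z * ev (pderiv q * [:0, 1:]) z"
proof -
  have "pderiv (smult b (Polynomial.monom 1 d - 1)) = p * pderiv q + q * pderiv p"
    unfolding assms(1) by (simp add: pderiv_mult)
  then have *: "smult b (Polynomial.monom (of_nat d) (d - 1)) = p * pderiv q + q * pderiv p"
    by (simp add: pderiv_smult pderiv_diff pderiv_monom)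
  from arg_cong[OF this, of "\<lambda>p. ev p z"]
  have "h b * (h (of_nat d) * z ^ (d - 1)) = ev (p * pderiv q) z"
    by (simp add: ev_smult ev_monom ev_add ev_mult assms(2))
  then have "h b * (h (of_nat d) * (z ^ (d - 1) * z)) = ev (p * pderiv q) z * z"
    by (simp add: mult.assoc)
  also have "z ^ (d - 1) * z = 1"
    using assms(3,4) by (metis power_minus_mult)
  finally have "h b * h (of_nat d) = ev p z * (ev (pderiv q) z * z)"
    by (simp only: ev_mult mult.assoc mult_1_right)
  moreover have "ev [:0, 1:] z = z"
    by (simp add: ev_pCons hom_zero hom_one)
  ultimately show ?thesis
    by (simp only: ev_mult)
qed

end

text \<open>Integer coefficients serve divisibility by primes, rational ones serve field elements
  and Bezout identities.\<close>

interpretation int: coeff_hom "of_int :: int \<Rightarrow> complex"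
  by standard simp_all

interpretation rat: coeff_hom "of_rat :: rat \<Rightarrow> complex"
  by standard (simp_all add: of_rat_add of_rat_mult)

text \<open>The multiplier \<open>c\<close> is independent of \<open>z\<close>, so vanishing at a
  point and vanishing at its conjugates pass together between rational and integer
  polynomials.\<close>

lemma rat_poly_clear_denominators:
  fixes p :: "rat poly"
  shows "\<exists>c P. c \<noteq> (0::int) \<and> (\<forall>z. int.ev P z = of_int c * rat.ev p z)"
proof (induction p)
  case 0
  show ?case
    by (rule exI[of _ 1], rule exI[of _ 0]) simp
next
  case (pCons a p)
  then obtain c P where cP: "c \<noteq> (0::int)" "\<And>z. int.ev P z = of_int c * rat.ev p z"
    by blast
  obtain u v :: int where uv: "a = of_int u / of_int v" "v \<noteq> 0"
    by (metis Fract_of_int_quotient quotient_of_div quotient_of_denom_pos less_irrefl surj_pair)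
  \<comment> \<open>The denominator \<open>v\<close> of the new coefficient enlarges the multiplier
    to \<open>c * v\<close>; the constant term becomes \<open>c * v * a = c * u\<close>.\<close>
  have "int.ev (pCons (c * u) (smult v P)) z = of_int (c * v) * rat.ev (pCons a p) z" for z
    using uv(2) cP(2)[of z] by (simp add: int.ev_pCons rat.ev_pCons int.ev_smult uv(1) of_rat_divide field_simps)
  then show ?case
    using cP(1) uv(2) by (metis mult_eq_0_iff)
qed

section \<open>The Frobenius congruence\<close>

lemma prime_binomial_power:
  fixes a b :: "'r::comm_ring_1"
  assumes "Factorial_Ring.prime (q::nat)"
  shows "\<exists>c. (a + b) ^ q = a ^ q + b ^ q + of_nat q * c"
proof -
  have q: "q > 0" "q \<noteq> 0" using assms prime_gt_0_nat by auto
  have "(a + b) ^ q = (\<Sum>k\<le>q. of_nat (q choose k) * a ^ k * b ^ (q - k))"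
    by (rule binomial_ring)
  \<comment> \<open>Only the two end terms survive modulo \<open>q\<close>, which divides all inner
    binomial coefficients.\<close>
  also have "{..q} = insert 0 (insert q {0<..<q})"
    using q by auto
  also have "(\<Sum>k\<in>insert 0 (insert q {0<..<q}). of_nat (q choose k) * a ^ k * b ^ (q - k))
      = b ^ q + (a ^ q + (\<Sum>k\<in>{0<..<q}. of_nat (q choose k) * a ^ k * b ^ (q - k)))"
    using q by simp
  also have "(\<Sum>k\<in>{0<..<q}. of_nat (q choose k) * a ^ k * b ^ (q - k))
      = (\<Sum>k\<in>{0<..<q}. of_nat q * (of_nat ((q choose k) div q) * a ^ k * b ^ (q - k)))"
  proof (rule sum.cong)
    fix k assume "k \<in> {0<..<q}"
    then have "q dvd (q choose k)"
      using assms dvd_choose_prime[of k q] by auto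
    then have "of_nat (q choose k) = (of_nat q * of_nat ((q choose k) div q) :: 'r)"
      by (metis dvd_mult_div_cancel of_nat_mult)
    then show "of_nat (q choose k) * a ^ k * b ^ (q - k)
        = of_nat q * (of_nat ((q choose k) div q) * a ^ k * b ^ (q - k))"
      by (simp add: mult.assoc)
  qed simp
  also have "\<dots> = of_nat q * (\<Sum>k\<in>{0<..<q}. of_nat ((q choose k) div q) * a ^ k * b ^ (q - k))"
    by (simp add: sum_distrib_left)
  finally show ?thesis
    by (metis (no_types, lifting) add.assoc add.commute)
qed

text \<open>Fermat's little theorem, by induction with the binomial congruence; negative integers
  are reached through their residues modulo \<open>q\<close>.\<close>

lemma prime_dvd_power_minus_self:
  fixes a :: int
  assumes "Factorial_Ring.prime (q::nat)"
  shows "int q dvd a ^ q - a"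
proof -
  have nat: "int q dvd int k ^ q - int k" for k
  proof (induction k)
    case 0
    then show ?case using prime_gt_0_nat[OF assms] by (simp add: zero_power)
  next
    case (Suc k)
    obtain c where "(int k + 1) ^ q = int k ^ q + 1 ^ q + int q * c"
      using prime_binomial_power[OF assms, of "int k" 1] by auto
    then have "int (Suc k) ^ q - int (Suc k) = (int k ^ q - int k) + int q * c"
      by (simp add: add.commute)
    then show ?case
      using Suc by (metis dvd_add dvd_triv_left)
  qed
  have "[a ^ q = (a mod int q) ^ q] (mod int q)"
    by (simp add: Cong.cong_def power_mod)
  also have "[(a mod int q) ^ q = a mod int q] (mod int q)"
    using nat[of "nat (a mod int q)"] prime_gt_0_nat[OF assms] by (simp add: cong_iff_dvd_diff)
  also have "[a mod int q = a] (mod int q)"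
    by (simp add: Cong.cong_def)
  finally show ?thesis
    by (simp add: cong_iff_dvd_diff)
qed

text \<open>Modulo \<open>q\<close>, raising \<open>a + X f\<close> to the power \<open>q\<close>
  acts on each summand separately, and Fermat's theorem takes \<open>a ^ q\<close> back to
  \<open>a\<close>.\<close>

lemma pcompose_monom_prime:
  fixes f :: "int poly"
  assumes "Factorial_Ring.prime (q::nat)"
  shows "\<exists>r. pcompose f (Polynomial.monom 1 q) = f ^ q + smult (int q) r"
proof (induction f)
  case 0
  then show ?case using prime_gt_0_nat[OF assms] by (intro exI[of _ 0]) (simp add: zero_power)
next
  case (pCons a f)
  let ?X = "[:0, 1:] :: int poly"
  obtain r where r: "pcompose f (Polynomial.monom 1 q) = f ^ q + smult (int q) r"
    using pCons by blast
  obtain c where c: "([:a:] + ?X * f) ^ q = [:a:] ^ q + (?X * f) ^ q + of_nat q * c"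
    using prime_binomial_power[OF assms] by blast
  obtain e where e: "a ^ q - a = int q * e"
    using prime_dvd_power_minus_self[OF assms] by blast
  have X: "Polynomial.monom 1 q = ?X ^ q"
    by (metis monom_altdef smult_1_left)
  have "pCons a f = [:a:] + ?X * f"
    by simp
  then have 1: "pCons a f ^ q = [:a ^ q:] + ?X ^ q * f ^ q + smult (int q) c"
    by (simp only: c) (simp only: power_mult_distrib poly_const_pow, simp add: of_nat_poly)
  have 2: "pcompose (pCons a f) (Polynomial.monom 1 q) = [:a:] + ?X ^ q * (f ^ q + smult (int q) r)"
    unfolding pcompose_pCons r by (simp only: X)
  obtain K where 3: "[:a ^ q:] = [:a:] + smult (int q) K"
    using e by (intro that[of "[:e:]"]) simp
  \<comment> \<open>The error collects the inductive one, the cross terms \<open>c\<close> of the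
    binomial and the Fermat quotient \<open>K\<close>.\<close>
  have "pcompose (pCons a f) (Polynomial.monom 1 q)
      = pCons a f ^ q + smult (int q) (?X ^ q * r - c - K)"
    unfolding 1 2 3 by (simp add: algebra_simps smult_diff_right smult_add_right)
  then show ?case by blast
qed

section \<open>Conjugates and inverses of values at roots of unity\<close>

lemma coprime_shift:
  fixes m d N :: nat
  assumes "coprime m d" and "N > 0"
  shows "\<exists>t>0. coprime (m + d * t) N"
proof -
  \<comment> \<open>With \<open>t\<close> the product of \<open>P\<close>, a prime divisor of
    \<open>N\<close> divides exactly one of \<open>m\<close> and \<open>d * t\<close>: if it divides
    \<open>m\<close>, it divides neither \<open>d\<close> nor \<open>t\<close>, and otherwise it
    lies in \<open>P\<close>.\<close>
  define P where "P = {p. Factorial_Ring.prime p \<and> p dvd N \<and> \<not> p dvd m}"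
  have fin: "finite P"
    using assms(2) by (intro finite_subset[OF _ finite_divisors_nat[of N]]) (auto simp: P_def)
  have "coprime (m + d * \<Prod>P) N"
  proof (rule ccontr)
    assume "\<not> coprime (m + d * \<Prod>P) N"
    then have "gcd (m + d * \<Prod>P) N \<noteq> 1"
      by (simp add: coprime_iff_gcd_eq_1)
    from prime_factor_nat[OF this] obtain p
      where p: "Factorial_Ring.prime p" "p dvd m + d * \<Prod>P" "p dvd N"
      by auto
    show False
    proof (cases "p dvd m")
      case True
      then have "p dvd d * \<Prod>P"
        using p(2) by (simp add: dvd_add_right_iff)
      moreover have "\<not> p dvd d"
        using True assms(1) p(1) by (meson coprime_common_divisor not_prime_unit)
      ultimately have "p dvd \<Prod>P"
        using p(1) prime_dvd_mult_iff by blast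
      then obtain p' where "p' \<in> P" "p dvd p'"
        using prime_dvd_prod_iff[OF fin p(1), of "\<lambda>x. x"] by auto
      then show False
        using p(1) True primes_dvd_imp_eq by (auto simp: P_def)
    next
      case False
      then have "p \<in> P" using p by (simp add: P_def)
      then have "p dvd d * \<Prod>P"
        using dvd_prodI[OF fin, of p "\<lambda>x. x"] by (simp add: dvd_mult)
      then show False
        using False p(2) by (simp add: dvd_add_left_iff)
    qed
  qed
  moreover have "\<Prod>P > 0"
    by (rule prod_pos) (auto simp: P_def prime_gt_0_nat)
  ultimately show ?thesis by blast
qed

text \<open>If \<open>l\<close> is the leading coefficient of \<open>f\<close>, then \<open>\<int>[1/l][z]\<close> is free over \<open>\<int>[1/l]\<close>, so divisibility by
  a prime not dividing \<open>l\<close> descends to the integers.\<close>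

lemma prime_dvd_via_minimal_poly:
  fixes f r :: "int poly"
  assumes f: "f \<noteq> 0" "int.ev f z = 0"
    and min: "\<And>g. int.ev g z = 0 \<Longrightarrow> g \<noteq> 0 \<Longrightarrow> degree f \<le> degree g"
    and q: "Factorial_Ring.prime (q::nat)" "\<not> int q dvd lead_coeff f"
    and N: "of_int N = of_nat q * int.ev r z"
  shows "int q dvd N"
proof -
  \<comment> \<open>Pseudo-division keeps the coefficients integral at the price of a power of
    \<open>lead_coeff f\<close>, which is cancelled at the end because \<open>q\<close> does not
    divide it.\<close>
  obtain u v where uv: "pseudo_divmod r f = (u, v)"
    by fastforce
  define e where "e = Suc (degree r) - degree f"
  have 1: "smult (lead_coeff f ^ e) r = f * u + v" and 2: "v = 0 \<or> degree v < degree f"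
    using pseudo_divmod[OF f(1) uv] by (simp_all add: e_def)
  have "int.ev v z = of_int (lead_coeff f ^ e) * int.ev r z"
    using arg_cong[OF 1, of "\<lambda>p. int.ev p z"] f(2) by (simp add: int.ev_smult int.ev_add int.ev_mult)
  then have 3: "int.ev (smult (int q) v - [:lead_coeff f ^ e * N:]) z = 0"
    by (simp add: int.ev_diff int.ev_smult int.ev_const N)
  have "degree f > 0"
  proof (rule ccontr)
    assume "\<not> degree f > 0"
    then obtain a where "f = [:a:]" by (metis degree_eq_zeroE gr0I)
    then show False using f by (simp add: int.ev_const)
  qed
  then have "degree (smult (int q) v - [:lead_coeff f ^ e * N:]) < degree f"
    using 2 by (intro degree_diff_less) auto
  \<comment> \<open>The difference vanishes at \<open>z\<close> in degree below the minimum, so it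
    is the zero polynomial, and the constant terms can be compared.\<close>
  then have "smult (int q) v = [:lead_coeff f ^ e * N:]"
    using min[OF 3] by fastforce
  from arg_cong[OF this, of "\<lambda>p. coeff p 0"] have "int q dvd lead_coeff f ^ e * N"
    by (metis coeff_pCons_0 coeff_smult dvd_triv_left)
  then show ?thesis
    using q by (meson prime_dvd_mult_iff prime_dvd_power prime_nat_int_transfer)
qed

text \<open>It suffices to treat one polynomial \<open>f\<close> of least degree, since up to a
  nonzero integer factor it divides every integer polynomial vanishing at \<open>z\<close>.
  Exponents coprime to \<open>N\<close> are built up prime by prime, and \<open>m\<close> is
  congruent modulo \<open>d\<close> to one of them.\<close>

lemma root_of_unity_conjugate_int:
  fixes p :: "int poly" and z :: complex
  assumes z: "z ^ d = 1" and d: "d > 0" and p: "int.ev p z = 0" and m: "coprime m d"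
  shows "int.ev p (z ^ m) = 0"
proof -
  let ?C = "Polynomial.monom 1 d - 1 :: int poly"
  have evC: "int.ev ?C z = 0"
    by (simp add: int.ev_cyclo z)
  have C0: "?C \<noteq> 0"
  proof
    assume "?C = 0"
    from arg_cong[OF this, of "\<lambda>p. coeff p d"] show False
      using d by (simp add: coeff_1)
  qed
  define f where "f = arg_min degree (\<lambda>g. g \<noteq> 0 \<and> int.ev g z = 0)"
  have f: "f \<noteq> 0 \<and> int.ev f z = 0"
    unfolding f_def by (rule arg_min_natI[of _ ?C]) (use C0 evC in blast)
  have min: "degree f \<le> degree g" if "int.ev g z = 0" "g \<noteq> 0" for g
    unfolding f_def by (rule arg_min_nat_le) (use that in blast)
  have dvd: "\<exists>a u. a \<noteq> 0 \<and> smult a g = f * u" if "int.ev g z = 0" for g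
  proof -
    obtain a u where a: "a \<noteq> 0" "smult a g = f * u + pseudo_mod g f"
      using pseudo_mod(1)[of f g] f by blast
    have "int.ev (pseudo_mod g f) z = 0"
      using arg_cong[OF a(2), of "\<lambda>p. int.ev p z"] f that
      by (simp add: int.ev_smult int.ev_add int.ev_mult)
    then have "pseudo_mod g f = 0"
      using pseudo_mod(2)[of f g] f min by fastforce
    then show ?thesis using a by auto
  qed
  obtain b g where b: "b \<noteq> 0" "smult b ?C = f * g"
    using dvd[OF evC] by blast
  \<comment> \<open>\<open>N\<close> collects the primes to avoid: those dividing
    \<open>lead_coeff f\<close> block the descent to the integers, those dividing
    \<open>b * d\<close> block the contradiction.\<close>
  define N where "N = nat \<bar>lead_coeff f * b * int d\<bar>"
  have "N > 0"
    using b f d by (simp add: N_def)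
  have step: "int.ev f (z ^ (q * k)) = 0"
    if q: "Factorial_Ring.prime q" "\<not> q dvd N" and k: "int.ev f (z ^ k) = 0" for q k
  proof (rule ccontr)
    assume nz: "int.ev f (z ^ (q * k)) \<noteq> 0"
    define y where "y = z ^ (q * k)"
    have yk: "y = (z ^ k) ^ q"
      by (simp add: y_def power_mult mult.commute)
    have y1: "y ^ d = 1"
      by (metis y_def power_mult mult.commute power_one z)
    have "int.ev f y * int.ev g y = int.ev (smult b ?C) y"
      unfolding b(2) by (simp add: int.ev_mult)
    then have "int.ev g y = 0"
      using nz y1 by (simp add: int.ev_smult int.ev_cyclo y_def)
    \<comment> \<open>As \<open>y\<close> is a root of \<open>g\<close>, the number
      \<open>b * d\<close> is a multiple of \<open>f(y)\<close>; since \<open>f\<close> vanishes at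
      \<open>z ^ k\<close>, the Frobenius congruence makes \<open>f(y)\<close> a multiple of
      \<open>q\<close>.\<close>
    from int.ev_cofactor[OF b(2) this y1 d]
    have *: "of_int (b * int d) = int.ev f y * int.ev (pderiv g * [:0, 1:]) y"
      by simp
    obtain r where r: "pcompose f (Polynomial.monom 1 q) = f ^ q + smult (int q) r"
      using pcompose_monom_prime[OF q(1)] by blast
    have "int.ev f y = of_nat q * int.ev r (z ^ k)"
      using arg_cong[OF r, of "\<lambda>p. int.ev p (z ^ k)"] k prime_gt_0_nat[OF q(1)]
      by (simp add: int.ev_pcompose int.ev_monom int.ev_add int.ev_power int.ev_smult yk zero_power)
    have comp: "int.ev h (z ^ j) = int.ev (pcompose h (Polynomial.monom 1 j)) z" for h j
      by (simp add: int.ev_pcompose int.ev_monom)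
    \<comment> \<open>Minimality of \<open>f\<close> refers to \<open>z\<close>, so values at
      \<open>z ^ k\<close> and at \<open>y\<close> are rewritten as values at
      \<open>z\<close>.\<close>
    define s where "s = pcompose r (Polynomial.monom 1 k)
      * pcompose (pderiv g * [:0, 1:]) (Polynomial.monom 1 (q * k))"
    have s: "of_int (b * int d) = of_nat q * int.ev s z"
      unfolding * \<open>int.ev f y = _\<close> unfolding y_def comp s_def int.ev_mult by (simp only: mult.assoc)
    have "\<not> int q dvd lead_coeff f * (b * int d)"
      using q(2) unfolding N_def by (simp add: mult.assoc nat_abs_dvd_iff int_dvd_int_iff flip: int_dvd_int_iff)
    then have "\<not> int q dvd lead_coeff f" and "\<not> int q dvd b * int d"
      by auto
    then show False
      using prime_dvd_via_minimal_poly[of f z q "b * int d" s] f min q(1) s by blast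
  qed
  \<comment> \<open>Induction over the prime factors of \<open>k\<close>, none of which divides
    \<open>N\<close>; it starts from \<open>f(z) = 0\<close> at \<open>k = 1\<close>.\<close>
  have all: "int.ev f (z ^ k) = 0" if "coprime k N" "k > 0" for k
    using that
  proof (induction k rule: prime_divisors_induct)
    case (factor q k)
    have "\<not> q dvd N"
      using factor.prems(1) factor.hyps by (metis coprime_common_divisor dvd_triv_left not_prime_unit)
    then show ?case
      using factor step by simp
  qed (use f in auto)
  \<comment> \<open>\<open>t > 0\<close> keeps the shifted exponent positive even when
    \<open>m = 0\<close>.\<close>
  obtain t where t: "t > 0" "coprime (m + d * t) N"
    using coprime_shift[OF m \<open>N > 0\<close>] by blast
  have "int.ev f (z ^ (m + d * t)) = 0"
    using all[OF t(2)] t(1) d by simp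
  moreover have "z ^ (m + d * t) = z ^ m"
    by (simp add: power_add power_mult z)
  ultimately have fm: "int.ev f (z ^ m) = 0"
    by simp
  obtain a u where "a \<noteq> 0" "smult a p = f * u"
    using dvd[OF p] by blast
  then have "of_int a * int.ev p (z ^ m) = int.ev f (z ^ m) * int.ev u (z ^ m)"
    by (metis int.ev_smult int.ev_mult)
  then show ?thesis
    using fm \<open>a \<noteq> 0\<close> by simp
qed

lemma root_of_unity_conjugate:
  fixes p :: "rat poly" and z :: complex
  assumes "z ^ d = 1" and "d > 0" and "rat.ev p z = 0" and "coprime m d"
  shows "rat.ev p (z ^ m) = 0"
proof -
  obtain c P where "c \<noteq> (0::int)" and P: "\<And>z. int.ev P z = of_int c * rat.ev p z"
    using rat_poly_clear_denominators by blast
  moreover have "int.ev P (z ^ m) = 0"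
    by (rule root_of_unity_conjugate_int) (use assms P in auto)
  ultimately show ?thesis by simp
qed

text \<open>A value \<open>p(z) \<noteq> 0\<close> at a root of unity is inverted by a Bezout identity for \<open>p\<close> and
  \<open>X\<^sup>d - 1\<close>: their gcd divides \<open>X\<^sup>d - 1\<close>, and its value at \<open>z\<close> is inverted by the derivative
  of the complementary factor.\<close>

lemma root_of_unity_inverse:
  fixes p :: "rat poly" and z :: complex
  assumes z: "z ^ d = 1" and d: "d > 0" and p: "rat.ev p z \<noteq> 0"
  shows "\<exists>s. inverse (rat.ev p z) = rat.ev s z"
proof -
  let ?C = "Polynomial.monom 1 d - 1 :: rat poly"
  define h where "h = gcd p ?C"
  obtain u v where uv: "u * p + v * ?C = h"
    unfolding h_def by (metis bezout_coefficients_fst_snd)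
  have hp: "h dvd p" and hC: "h dvd ?C"
    by (simp_all add: h_def)
  obtain k where k: "?C = h * k"
    using hC by blast
  have hz: "rat.ev h z \<noteq> 0"
    using hp p by (metis dvdE mult_zero_left rat.ev_mult)
  have "rat.ev h z * rat.ev k z = 0"
    by (metis k rat.ev_mult rat.ev_cyclo z diff_self)
  then have "rat.ev k z = 0"
    using hz by simp
  then have 1: "of_nat d = rat.ev h z * rat.ev (pderiv k * [:0, 1:]) z"
    using rat.ev_cofactor[of 1 d h k z] k z d by simp
  \<comment> \<open>At \<open>z\<close> the term with \<open>X^d - 1\<close> drops out of the Bezout
    identity, so dividing the cofactor identity by \<open>d\<close> displays the inverse.\<close>
  have 2: "rat.ev h z = rat.ev u z * rat.ev p z"
    by (simp add: rat.ev_add rat.ev_mult rat.ev_cyclo z flip: uv)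
  have "rat.ev p z * (rat.ev u z * rat.ev (pderiv k * [:0, 1:]) z / of_nat d) = 1"
    using arg_cong[OF 1, of "\<lambda>x. x / of_nat d"] d unfolding 2
    by (simp only: mult.assoc mult.left_commute times_divide_eq_right) simp
  then have "inverse (rat.ev p z) = rat.ev (smult (1 / of_nat d) (u * (pderiv k * [:0, 1:]))) z"
    by (simp only: rat.ev_smult rat.ev_mult of_rat_divide of_rat_1 of_rat_of_nat_eq
        inverse_unique) (simp add: mult.assoc)
  then show ?thesis by blast
qed

section \<open>Cyclotomic fields\<close>

lemma zeta_power: "zeta d ^ k = cis (2 * pi * real k / real d)"
  unfolding zeta_def exp_of_nat_mult[symmetric] cis_conv_exp
  by (simp add: algebra_simps)

lemma inj_on_zeta_power:
  assumes "n > 0"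
  shows "inj_on (\<lambda>k. zeta n ^ k) {..<n}"
  using bij_betw_roots_unity[OF assms] by (simp add: bij_betw_def zeta_power)

lemma zeta_power_self:
  assumes "d > 0"
  shows "zeta d ^ d = 1"
  using assms by (simp add: zeta_power)

lemma root_of_unity_power_mod:
  fixes z :: complex
  assumes "z ^ d = 1"
  shows "z ^ (k mod d) = z ^ k"
proof -
  have "z ^ k = z ^ (d * (k div d) + k mod d)"
    by simp
  also have "\<dots> = z ^ (k mod d)"
    by (simp only: power_add power_mult assms) simp
  finally show ?thesis ..
qed

lemma zeta_power_eq_1_iff:
  assumes "d > 0"
  shows "zeta d ^ k = 1 \<longleftrightarrow> d dvd k"
proof
  assume "zeta d ^ k = 1"
  then have "zeta d ^ (k mod d) = zeta d ^ 0"
    using root_of_unity_power_mod[OF zeta_power_self[OF assms]] by simp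
  then have "k mod d = 0"
    using inj_onD[OF inj_on_zeta_power[OF assms], of "k mod d" 0] assms by simp
  then show "d dvd k" by auto
next
  assume "d dvd k"
  then show "zeta d ^ k = 1"
    by (metis dvdE power_mult zeta_power_self[OF assms] power_one)
qed

lemma zeta_power_div:
  assumes "n > 0" and "k dvd n"
  shows "zeta n ^ (k * j) = zeta (n div k) ^ j"
proof -
  have "k > 0" using assms by (metis dvd_0_left gr0I less_irrefl)
  then have "2 * pi * real (k * j) / real n = 2 * pi * real j / real (n div k)"
    using assms by (auto elim!: dvdE)
  then show ?thesis
    by (simp only: zeta_power)
qed

section \<open>Cyclotomic fields as sets of polynomial values\<close>

lemma complex_algebra_inv:
  assumes "x \<noteq> 0"
  shows "inv\<^bsub>complex_algebra\<^esub> x = inverse x"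
  unfolding m_inv_def complex_algebra_def
  using assms by (auto intro!: the_equality simp: inverse_unique)

lemma complex_algebra_minus: "\<ominus>\<^bsub>complex_algebra\<^esub> x = - x"
  unfolding a_inv_def m_inv_def complex_algebra_def
  by (rule the_equality) (auto simp: eq_neg_iff_add_eq_0 add.commute)

text \<open>Polynomial values at \<open>zeta d\<close> are closed even under inversion, by
  \<open>root_of_unity_inverse\<close>. Representing elements by polynomials allows automorphisms to
  be given by substitution.\<close>

lemma carrier_cyclotomic_field:
  assumes "d > 0"
  shows "carrier (cyclotomic_field d) = range (\<lambda>p. rat.ev p (zeta d))"
proof -
  let ?K = "generate_field complex_algebra (\<rat> \<union> {zeta d})"
  have X: "rat.ev [:0, 1:] (zeta d) = zeta d"
    by (simp add: rat.ev_pCons)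
  have "x \<in> range (\<lambda>p. rat.ev p (zeta d))" if "x \<in> ?K" for x
    using that
  proof induction
    case one
    show ?case by (rule image_eqI[of _ _ 1]) (simp_all add: complex_algebra_def)
  next
    case (incl x)
    then show ?case
    proof
      assume "x \<in> \<rat>"
      then obtain a where "x = of_rat a" by (auto elim: Rats_cases)
      then show ?thesis by (intro image_eqI[of _ _ "[:a:]"]) (simp_all add: rat.ev_const)
    next
      assume "x \<in> {zeta d}"
      then show ?thesis using X by (intro image_eqI[of _ _ "[:0, 1:]"]) simp_all
    qed
  next
    case (a_inv x)
    then obtain p where "x = rat.ev p (zeta d)" by auto
    then show ?case by (intro image_eqI[of _ _ "- p"]) (simp_all add: complex_algebra_minus rat.ev_minus)
  next
    case (m_inv x)
    then have "x \<noteq> 0" by (simp add: complex_algebra_def)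
    then show ?case
      using m_inv.IH root_of_unity_inverse[OF zeta_power_self[OF assms] assms]
      by (auto simp: complex_algebra_inv)
  next
    case (eng_add x y)
    then obtain p q where "x = rat.ev p (zeta d)" "y = rat.ev q (zeta d)" by auto
    then show ?case by (intro image_eqI[of _ _ "p + q"]) (simp_all add: complex_algebra_def rat.ev_add)
  next
    case (eng_mult x y)
    then obtain p q where "x = rat.ev p (zeta d)" "y = rat.ev q (zeta d)" by auto
    then show ?case by (intro image_eqI[of _ _ "p * q"]) (simp_all add: complex_algebra_def rat.ev_mult)
  qed
  moreover have "rat.ev p (zeta d) \<in> ?K" for p
  proof (induction p)
    case 0
    have "(0::complex) \<in> \<rat>" by simp
    then show ?case by (auto intro: generate_field.incl)
  next
    case (pCons a p)
    have "of_rat a \<in> ?K" and "zeta d \<in> ?K"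
      by (auto intro: generate_field.incl)
    then have "of_rat a \<oplus>\<^bsub>complex_algebra\<^esub> (zeta d \<otimes>\<^bsub>complex_algebra\<^esub> rat.ev p (zeta d)) \<in> ?K"
      using pCons by (intro generate_field.eng_add generate_field.eng_mult)
    then show ?case
      by (simp add: rat.ev_pCons complex_algebra_def)
  qed
  ultimately show ?thesis
    by (auto simp: cyclotomic_field_def)
qed

lemma cyclotomic_field_simps:
  "monoid.mult (cyclotomic_field d) = (*)" "monoid.one (cyclotomic_field d) = 1"
  "ring.add (cyclotomic_field d) = (+)"  "ring.zero (cyclotomic_field d) = 0"
  "module.smult (cyclotomic_field d) = (\<lambda>q z. of_rat q * z)"
  by (simp_all add: cyclotomic_field_def complex_algebra_def)

section \<open>Automorphisms of cyclotomic fields\<close>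

lemma additive_rat_unique:
  fixes f :: "rat \<Rightarrow> complex"
  assumes add: "\<And>x y. f (x + y) = f x + f y" and one: "f 1 = 1"
  shows "f q = of_rat q"
proof -
  have zero: "f 0 = 0"
    using add[of 0 0] by (metis add_cancel_right_right add_0)
  have nat: "f (of_nat k * x) = of_nat k * f x" for k x
    by (induction k) (simp_all add: zero add algebra_simps)
  have minus: "f (- x) = - f x" for x
    using add[of x "-x"] zero by (simp add: eq_neg_iff_add_eq_0 add.commute)
  have int: "f (of_int i) = of_int i" for i
  proof (cases i rule: int_cases2)
    case (nonneg k)
    then show ?thesis using nat[of k 1] one by simp
  next
    case (nonpos k)
    then show ?thesis using nat[of k 1] one by (simp add: minus)
  qed
  obtain a b where q: "q = of_int a / of_int b" "b > 0"
    by (metis quotient_of_div quotient_of_denom_pos surj_pair)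
  then have "of_nat (nat b) * f q = f (of_int a)"
    using nat[of "nat b" q] by simp
  then show ?thesis
    using q(2) unfolding q(1) by (simp add: int of_rat_divide field_simps)
qed

text \<open>Makes substitution of \<open>z ^ m\<close> for \<open>z\<close> well defined on values;
  used from \<open>z ^ m\<close> with an inverse exponent, it makes it injective.\<close>

lemma ev_eq_imp_conjugate_ev_eq:
  fixes z :: complex
  assumes "z ^ d = 1" and "d > 0" and "rat.ev p z = rat.ev q z" and "coprime m d"
  shows "rat.ev p (z ^ m) = rat.ev q (z ^ m)"
  using root_of_unity_conjugate[OF assms(1,2), of "p - q" m] assms(3,4)
  by (simp add: rat.ev_diff)

lemma ev_power_eq_ev_pcompose: "rat.ev p (z ^ m) = rat.ev (pcompose p (Polynomial.monom 1 m)) z"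
  by (simp add: rat.ev_pcompose rat.ev_monom)

text \<open>The map substitutes \<open>zeta d ^ m\<close> into a representing polynomial. An inverse
  \<open>m'\<close> of \<open>m\<close> modulo \<open>d\<close> undoes this, which gives
  bijectivity.\<close>

lemma ex_cyclotomic_aut:
  assumes d: "d > 0" and m: "coprime m d"
  shows "\<exists>\<tau>. \<tau> \<in> ring_iso (cyclotomic_field d) (cyclotomic_field d)
    \<and> \<tau> \<in> extensional (carrier (cyclotomic_field d))
    \<and> (\<forall>p. \<tau> (rat.ev p (zeta d)) = rat.ev p (zeta d ^ m))"
proof -
  let ?K = "cyclotomic_field d"
  note carr = carrier_cyclotomic_field[OF d]
  note z = zeta_power_self[OF d]
  \<comment> \<open>By conjugacy the chosen polynomial does not affect the value.\<close>
  define \<tau> where "\<tau> = (\<lambda>x\<in>carrier ?K. rat.ev (SOME p. rat.ev p (zeta d) = x) (zeta d ^ m))"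
  have \<tau>: "\<tau> (rat.ev p (zeta d)) = rat.ev p (zeta d ^ m)" for p
  proof -
    have "rat.ev (SOME q. rat.ev q (zeta d) = rat.ev p (zeta d)) (zeta d) = rat.ev p (zeta d)"
      by (rule someI) simp
    from ev_eq_imp_conjugate_ev_eq[OF z d this m] show ?thesis
      by (simp add: \<tau>_def carr)
  qed
  obtain m' where m': "[m * m' = 1] (mod d)"
    using cong_solve_coprime_nat[OF m] by auto
  have cop: "coprime m' d"
    using m' by (metis coprime_iff_invertible_nat mult.commute One_nat_def)
  have mm': "(zeta d ^ m) ^ m' = zeta d" "(zeta d ^ m') ^ m = zeta d"
    using m' root_of_unity_power_mod[OF z, of "m * m'"] root_of_unity_power_mod[OF z, of 1]
    by (simp_all add: Cong.cong_def mult.commute flip: power_mult)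
  have "inj_on \<tau> (carrier ?K)"
  proof (rule inj_onI)
    fix x y assume "x \<in> carrier ?K" "y \<in> carrier ?K" "\<tau> x = \<tau> y"
    then obtain p q where pq: "x = rat.ev p (zeta d)" "y = rat.ev q (zeta d)"
      and eq: "rat.ev p (zeta d ^ m) = rat.ev q (zeta d ^ m)"
      by (auto simp: carr \<tau>)
    \<comment> \<open>\<open>zeta d ^ m\<close> is again a \<open>d\<close>-th root of unity, so
      conjugacy applies to it with exponent \<open>m'\<close> and leads back to
      \<open>zeta d\<close>.\<close>
    have "(zeta d ^ m) ^ d = 1"
      by (metis z power_mult mult.commute power_one)
    from ev_eq_imp_conjugate_ev_eq[OF this d eq cop] show "x = y"
      by (simp add: pq mm')
  qed
  moreover have "\<tau> ` carrier ?K = carrier ?K"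
  proof -
    \<comment> \<open>The preimage is the value of \<open>p(X^m')\<close> at
      \<open>zeta d\<close>.\<close>
    have "rat.ev p (zeta d) = \<tau> (rat.ev (pcompose p (Polynomial.monom 1 m')) (zeta d))" for p
      unfolding \<tau> by (simp add: rat.ev_pcompose rat.ev_monom mm')
    then have "carrier ?K \<subseteq> \<tau> ` carrier ?K"
      unfolding carr by blast
    moreover have "\<tau> ` carrier ?K \<subseteq> carrier ?K"
      unfolding carr by (auto simp: \<tau> ev_power_eq_ev_pcompose)
    ultimately show ?thesis by blast
  qed
  ultimately have bij: "bij_betw \<tau> (carrier ?K) (carrier ?K)"
    by (simp add: bij_betw_def)
  have "\<tau> \<in> ring_hom ?K ?K"
  proof (rule ring_hom_memI)
    fix x y assume "x \<in> carrier ?K" "y \<in> carrier ?K"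
    then obtain p q where pq: "x = rat.ev p (zeta d)" "y = rat.ev q (zeta d)"
      by (auto simp: carr)
    show "\<tau> (x \<otimes>\<^bsub>?K\<^esub> y) = \<tau> x \<otimes>\<^bsub>?K\<^esub> \<tau> y"
      unfolding cyclotomic_field_simps pq by (simp only: \<tau> flip: rat.ev_mult)
    show "\<tau> (x \<oplus>\<^bsub>?K\<^esub> y) = \<tau> x \<oplus>\<^bsub>?K\<^esub> \<tau> y"
      unfolding cyclotomic_field_simps pq by (simp only: \<tau> flip: rat.ev_add)
  next
    show "\<tau> \<one>\<^bsub>?K\<^esub> = \<one>\<^bsub>?K\<^esub>"
      using \<tau>[of 1] by (simp add: cyclotomic_field_simps)
  qed (use bij in \<open>auto simp: bij_betw_def\<close>)
  then show ?thesis
    using bij \<tau> by (intro exI[of _ \<tau>]) (auto simp: ring_iso_def \<tau>_def)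
qed

text \<open>Resolves the definite description: the image of \<open>zeta d\<close> determines a ring
  automorphism on all polynomial values, and extensionality determines it elsewhere.\<close>

lemma cyclotomic_aut_ev:
  assumes d: "d > 0" and m: "coprime m d"
  shows "cyclotomic_aut d m (rat.ev p (zeta d)) = rat.ev p (zeta d ^ m)"
proof -
  let ?K = "cyclotomic_field d"
  note carr = carrier_cyclotomic_field[OF d]
  obtain \<tau> where iso: "\<tau> \<in> ring_iso ?K ?K" and ext: "\<tau> \<in> extensional (carrier ?K)"
    and \<tau>: "\<And>p. \<tau> (rat.ev p (zeta d)) = rat.ev p (zeta d ^ m)"
    using ex_cyclotomic_aut[OF assms] by blast
  have X: "rat.ev [:0, 1:] x = x" for x
    by (simp add: rat.ev_pCons)
  have "cyclotomic_aut d m = \<tau>"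
    unfolding cyclotomic_aut_def
  proof (rule the_equality)
    show "\<tau> \<in> ring_iso ?K ?K \<and> \<tau> \<in> extensional (carrier ?K) \<and> \<tau> (zeta d) = zeta d ^ m"
      using iso ext \<tau>[of "[:0, 1:]"] unfolding X by blast
  next
    fix \<sigma>
    assume \<sigma>: "\<sigma> \<in> ring_iso ?K ?K \<and> \<sigma> \<in> extensional (carrier ?K) \<and> \<sigma> (zeta d) = zeta d ^ m"
    then have hom: "\<sigma> \<in> ring_hom ?K ?K"
      by (simp add: ring_iso_def)
    have in_K: "rat.ev p (zeta d) \<in> carrier ?K" for p
      by (simp add: carr)
    have const_in_K: "of_rat a \<in> carrier ?K" for a
      using in_K[of "[:a:]"] by (simp add: rat.ev_const)
    have zeta_in_K: "zeta d \<in> carrier ?K"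
      using in_K[of "[:0, 1:]"] unfolding X .
    have mult: "\<sigma> (x * y) = \<sigma> x * \<sigma> y" and add: "\<sigma> (x + y) = \<sigma> x + \<sigma> y"
      if "x \<in> carrier ?K" "y \<in> carrier ?K" for x y
      using ring_hom_mult[OF hom that] ring_hom_add[OF hom that] by (simp_all add: cyclotomic_field_simps)
    \<comment> \<open>\<open>ring_iso\<close> does not ask that rationals be fixed; additivity and
      the value at \<open>1\<close> force it.\<close>
    have const: "\<sigma> (of_rat a) = of_rat a" for a
      using additive_rat_unique[of "\<lambda>a. \<sigma> (of_rat a)"] ring_hom_one[OF hom]
      by (simp add: of_rat_add add const_in_K cyclotomic_field_simps)
    have mult_in_K: "zeta d * rat.ev p (zeta d) \<in> carrier ?K" for p
      using in_K[of "[:0, 1:] * p"] unfolding rat.ev_mult X .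
    have "\<sigma> (rat.ev p (zeta d)) = rat.ev p (zeta d ^ m)" for p
    proof (induction p)
      case 0
      then show ?case using const[of 0] by simp
    next
      case (pCons a p)
      then show ?case
        using \<sigma> by (simp add: rat.ev_pCons add const const_in_K mult_in_K mult zeta_in_K in_K)
    qed
    then show "\<sigma> = \<tau>"
      using \<sigma> ext by (intro extensionalityI[of _ "carrier ?K"]) (auto simp: carr \<tau>)
  qed
  then show ?thesis
    by (simp add: \<tau>)
qed

section \<open>Joint evaluation at all divisors of \<open>n\<close>\<close>

text \<open>Products of these polynomials replace the cofactors of the cyclotomic polynomials in
  \<open>X\<^sup>n - 1\<close>, whose irreducible factorisation is thereby not needed.\<close>

lemma ev_separating_poly:
  assumes "d > 0" and "d' > 0" and "d \<noteq> d'"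
  defines "B \<equiv> (if d dvd d' then \<Sum>i<d' div d. Polynomial.monom 1 (d * i) else Polynomial.monom 1 d' - 1)"
  shows "rat.ev B (zeta d) \<noteq> 0" and "rat.ev B (zeta d') = 0"
proof -
  show "rat.ev B (zeta d) \<noteq> 0"
  proof (cases "d dvd d'")
    case True
    \<comment> \<open>Here \<open>B\<close> is the quotient of \<open>X^d' - 1\<close> by
      \<open>X^d - 1\<close>; each of its terms is \<open>1\<close> at
      \<open>zeta d\<close>.\<close>
    then have "rat.ev B (zeta d) = of_nat (d' div d)"
      using zeta_power_self[OF assms(1)] by (simp add: B_def rat.ev_sum rat.ev_monom power_mult)
    then show ?thesis
      using True assms(2) by (simp add: dvd_div_eq_0_iff)
  next
    case False
    then show ?thesis
      using zeta_power_eq_1_iff[OF assms(1)] by (simp add: B_def rat.ev_cyclo)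
  qed
  show "rat.ev B (zeta d') = 0"
  proof (cases "d dvd d'")
    case True
    have "\<not> d' dvd d"
      using True assms(3) by (meson dvd_antisym)
    then have "zeta d' ^ d - 1 \<noteq> 0"
      using zeta_power_eq_1_iff[OF assms(2)] by simp
    moreover have "(zeta d' ^ d - 1) * (\<Sum>i<d' div d. (zeta d' ^ d) ^ i) = (zeta d' ^ d) ^ (d' div d) - 1"
      by (rule power_diff_1_eq[symmetric])
    moreover have "(zeta d' ^ d) ^ (d' div d) = 1"
      using True zeta_power_self[OF assms(2)] by (simp flip: power_mult)
    ultimately show ?thesis
      using True by (simp add: B_def rat.ev_sum rat.ev_monom power_mult)
  next
    case False
    then show ?thesis
      using zeta_power_self[OF assms(2)] by (simp add: B_def rat.ev_cyclo)
  qed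
qed

text \<open>Lagrange interpolation: \<open>S d\<close> vanishes at every other
  \<open>zeta d'\<close>, and its value at \<open>zeta d\<close> is invertible within the field, so
  a multiple of it takes the prescribed value there.\<close>

lemma simultaneous_interpolation:
  assumes n: "n > 0" and x: "\<And>d. d dvd n \<Longrightarrow> x d \<in> carrier (cyclotomic_field d)"
  shows "\<exists>P. \<forall>d. d dvd n \<longrightarrow> rat.ev P (zeta d) = x d"
proof -
  let ?D = "{d. d dvd n}"
  have fin: "finite ?D"
    using n by simp
  have pos: "d > 0" if "d \<in> ?D" for d
    using that n by (auto intro: Nat.gr0I)
  have "\<exists>B. rat.ev B (zeta d) \<noteq> 0 \<and> rat.ev B (zeta d') = 0"
    if "d \<in> ?D" "d' \<in> ?D" "d \<noteq> d'" for d d'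
    using ev_separating_poly[OF pos[OF that(1)] pos[OF that(2)] that(3)] by blast
  then obtain B where B: "\<And>d d'. d \<in> ?D \<Longrightarrow> d' \<in> ?D \<Longrightarrow> d \<noteq> d' \<Longrightarrow>
      rat.ev (B d d') (zeta d) \<noteq> 0 \<and> rat.ev (B d d') (zeta d') = 0"
    by metis
  define S where "S d = (\<Prod>d'\<in>?D - {d}. B d d')" for d
  have S1: "rat.ev (S d) (zeta d) \<noteq> 0" if "d \<in> ?D" for d
    using that fin B[OF that] by (auto simp: S_def rat.ev_prod)
  have S0: "rat.ev (S d) (zeta d') = 0" if "d \<in> ?D" "d' \<in> ?D" "d \<noteq> d'" for d d'
    unfolding S_def rat.ev_prod using fin B[OF that] that by (intro prod_zero) auto
  have "\<exists>p. rat.ev p (zeta d) * rat.ev (S d) (zeta d) = x d" if dD: "d \<in> ?D" for d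
  proof -
    note d = pos[OF dD]
    obtain q where q: "x d = rat.ev q (zeta d)"
      using x[of d] dD carrier_cyclotomic_field[OF d] by auto
    obtain s where s: "inverse (rat.ev (S d) (zeta d)) = rat.ev s (zeta d)"
      using root_of_unity_inverse[OF zeta_power_self[OF d] d S1[OF dD]] by blast
    have "rat.ev (q * s) (zeta d) * rat.ev (S d) (zeta d) = x d"
      using S1[OF dD] by (simp add: rat.ev_mult q flip: s)
    then show ?thesis ..
  qed
  then obtain p where p: "\<And>d. d \<in> ?D \<Longrightarrow> rat.ev (p d) (zeta d) * rat.ev (S d) (zeta d) = x d"
    by metis
  have "rat.ev (\<Sum>d'\<in>?D. p d' * S d') (zeta d) = x d" if "d \<in> ?D" for d
  proof -
    have "rat.ev (\<Sum>d'\<in>?D. p d' * S d') (zeta d)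
        = (\<Sum>d'\<in>?D. if d' = d then x d else 0)"
      unfolding rat.ev_sum using S0[OF _ that] p[OF that]
      by (intro sum.cong) (auto simp: rat.ev_mult)
    then show ?thesis
      using fin that by simp
  qed
  then show ?thesis by blast
qed

text \<open>Conjugacy spreads the vanishing from the \<open>zeta d\<close> to all \<open>n\<close>
  powers of \<open>zeta n\<close>, too many roots for degree below \<open>n\<close>.\<close>

lemma vanishing_at_divisors:
  fixes a :: "nat \<Rightarrow> rat"
  assumes n: "n > 0" and z: "\<And>d. d dvd n \<Longrightarrow> (\<Sum>k<n. of_rat (a k) * zeta d ^ k) = 0" and k: "k < n"
  shows "a k = 0"
proof -
  define P where "P = (\<Sum>k<n. Polynomial.monom (a k) k)"
  have P: "rat.ev P x = (\<Sum>k<n. of_rat (a k) * x ^ k)" for x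
    by (simp add: P_def rat.ev_sum rat.ev_monom)
  have root: "rat.ev P (zeta n ^ j) = 0" for j
  proof -
    \<comment> \<open>Cancelling the gcd writes \<open>zeta n ^ j\<close> as a power of
      \<open>zeta (n div c)\<close> with exponent coprime to \<open>n div c\<close>; for
      \<open>j = 0\<close> this is \<open>d = 1\<close>.\<close>
    define c where "c = gcd j n"
    have c: "c dvd n" "j = c * (j div c)" "c > 0"
      using n by (simp_all add: c_def)
    define d where "d = n div c"
    have d: "d dvd n" "d > 0"
      using n c by (auto simp: d_def div_greater_zero_iff dvd_imp_le div_dvd_iff_mult)
    have "zeta n ^ j = zeta d ^ (j div c)"
      using zeta_power_div[OF n c(1), of "j div c"] c(2) by (simp add: d_def)
    moreover have "rat.ev P (zeta d ^ (j div c)) = 0"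
    proof (rule root_of_unity_conjugate[OF zeta_power_self[OF d(2)] d(2)])
      show "rat.ev P (zeta d) = 0"
        using z[OF d(1)] by (simp add: P)
      show "coprime (j div c) d"
        unfolding c_def d_def using n by (intro div_gcd_coprime) simp
    qed
    ultimately show ?thesis by simp
  qed
  have "map_poly of_rat P = (0 :: complex poly)"
  proof (rule ccontr)
    assume nz: "map_poly of_rat P \<noteq> (0 :: complex poly)"
    have "n = card ((\<lambda>j. zeta n ^ j) ` {..<n})"
      by (simp add: card_image inj_on_zeta_power[OF n])
    also have "\<dots> \<le> card {x. rat.ev P x = 0}"
      using root by (intro card_mono poly_roots_finite nz) auto
    also have "\<dots> \<le> degree (map_poly of_rat P :: complex poly)"
      by (rule card_poly_roots_bound[OF nz])
    also have "\<dots> \<le> degree P"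
      by (rule map_poly_degree_leq)
    also have "\<dots> \<le> n - 1"
      unfolding P_def by (rule degree_sum_le) (auto intro: order.trans[OF degree_monom_le])
    finally show False
      using n by simp
  qed
  then have "P = 0"
    by (simp add: map_poly_eq_0_iff)
  then have "coeff P k = 0"
    by simp
  then show ?thesis
    using k by (simp add: P_def coeff_sum)
qed

section \<open>Characters of a finite cyclic group\<close>

definition linear_functional :: "('a \<Rightarrow> complex) \<Rightarrow> ('a \<Rightarrow>\<^sub>0 rat) \<Rightarrow> complex"
  where "linear_functional \<chi> \<alpha> =
    (\<Sum>x\<in>Poly_Mapping.keys \<alpha>. of_rat (Poly_Mapping.lookup \<alpha> x) * \<chi> x)"

lemma linear_functional_superset:
  assumes "finite S" and "Poly_Mapping.keys \<alpha> \<subseteq> S"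
  shows "linear_functional \<chi> \<alpha> = (\<Sum>x\<in>S. of_rat (Poly_Mapping.lookup \<alpha> x) * \<chi> x)"
  unfolding linear_functional_def using assms
  by (intro sum.mono_neutral_left) (auto simp: in_keys_iff)

lemma linear_functional_0: "linear_functional \<chi> 0 = 0"
  by (simp add: linear_functional_def)

lemma linear_functional_add:
  "linear_functional \<chi> (\<alpha> + \<beta>) = linear_functional \<chi> \<alpha> + linear_functional \<chi> \<beta>"
proof -
  let ?S = "Poly_Mapping.keys \<alpha> \<union> Poly_Mapping.keys \<beta>"
  have "linear_functional \<chi> \<gamma> = (\<Sum>x\<in>?S. of_rat (Poly_Mapping.lookup \<gamma> x) * \<chi> x)"
    if "\<gamma> \<in> {\<alpha>, \<beta>, \<alpha> + \<beta>}" for \<gamma>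
    using that Poly_Mapping.keys_add[of \<alpha> \<beta>] by (intro linear_functional_superset) auto
  then show ?thesis
    by (simp add: lookup_add of_rat_add distrib_right sum.distrib)
qed

lemma linear_functional_sum:
  "linear_functional \<chi> (sum f S) = (\<Sum>i\<in>S. linear_functional \<chi> (f i))"
  by (induction S rule: infinite_finite_induct) (simp_all add: linear_functional_0 linear_functional_add)

lemma linear_functional_single:
  "linear_functional \<chi> (Poly_Mapping.single x a) = of_rat a * \<chi> x"
  by (subst linear_functional_superset[of "{x}"]) auto

text \<open>Moves the action from the group algebra to the function, where it can be compared with
  the action on the fields.\<close>

lemma linear_functional_linear_extension:
  "linear_functional \<chi> (linear_extension \<sigma> \<alpha>) = linear_functional (\<lambda>x. \<chi> (\<sigma> x)) \<alpha>"
  unfolding linear_extension_def linear_functional_sum linear_functional_single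
  by (simp add: linear_functional_def)

lemma linear_functional_smult:
  "linear_functional \<chi> (q \<odot>\<^bsub>group_algebra G\<^esub> \<alpha>) = of_rat q * linear_functional \<chi> \<alpha>"
proof -
  have lookup: "Poly_Mapping.lookup (Poly_Mapping.map ((*) q) \<alpha>) x = q * Poly_Mapping.lookup \<alpha> x" for x
    by (simp add: Poly_Mapping.map.rep_eq when_def)
  have "linear_functional \<chi> (Poly_Mapping.map ((*) q) \<alpha>)
      = (\<Sum>x\<in>Poly_Mapping.keys \<alpha>. of_rat (q * Poly_Mapping.lookup \<alpha> x) * \<chi> x)"
    unfolding lookup[symmetric] by (rule linear_functional_superset) (auto simp: in_keys_iff lookup)
  then show ?thesis
    by (simp add: group_algebra_def linear_functional_def of_rat_mult sum_distrib_left mult.assoc)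
qed

lemma linear_functional_mult:
  assumes "Poly_Mapping.keys \<alpha> \<subseteq> carrier G" and "Poly_Mapping.keys \<beta> \<subseteq> carrier G"
    and "\<And>x y. x \<in> carrier G \<Longrightarrow> y \<in> carrier G \<Longrightarrow> \<chi> (x \<otimes>\<^bsub>G\<^esub> y) = \<chi> x * \<chi> y"
  shows "linear_functional \<chi> (\<alpha> \<otimes>\<^bsub>group_algebra G\<^esub> \<beta>) = linear_functional \<chi> \<alpha> * linear_functional \<chi> \<beta>"
proof -
  have "linear_functional \<chi> (\<alpha> \<otimes>\<^bsub>group_algebra G\<^esub> \<beta>)
      = (\<Sum>x\<in>Poly_Mapping.keys \<alpha>. \<Sum>y\<in>Poly_Mapping.keys \<beta>.
          of_rat (Poly_Mapping.lookup \<alpha> x * Poly_Mapping.lookup \<beta> y) * \<chi> (x \<otimes>\<^bsub>G\<^esub> y))"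
    by (simp add: group_algebra_def linear_functional_sum linear_functional_single)
  also have "\<dots> = (\<Sum>x\<in>Poly_Mapping.keys \<alpha>. \<Sum>y\<in>Poly_Mapping.keys \<beta>.
      (of_rat (Poly_Mapping.lookup \<alpha> x) * \<chi> x) * (of_rat (Poly_Mapping.lookup \<beta> y) * \<chi> y))"
    using assms by (intro sum.cong refl) (auto simp: of_rat_mult subset_iff)
  finally show ?thesis
    by (simp add: linear_functional_def sum_product)
qed

lemma keys_linear_extension:
  assumes "Poly_Mapping.keys \<alpha> \<subseteq> S" and "\<sigma> ` S \<subseteq> T"
  shows "Poly_Mapping.keys (linear_extension \<sigma> \<alpha>) \<subseteq> T"
  unfolding linear_extension_def
  using assms by (intro order.trans[OF Poly_Mapping.keys_sum]) (auto split: if_splits)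

section \<open>Evaluations of the group algebra of a cyclic group\<close>

locale finite_cyclic_group = group G for G :: "('a, 'b) monoid_scheme" (structure) +
  fixes g :: 'a and n :: nat
  assumes g: "g \<in> carrier G"
    and n: "n > 0"
    and generated: "x \<in> carrier G \<Longrightarrow> \<exists>k::nat. x = g [^] k"
    and pow_eq_iff: "g [^] k = g [^] l \<longleftrightarrow> k mod n = l mod n"
begin

text \<open>The exponent is determined only modulo \<open>n\<close>, which is harmless for powers of
  \<open>zeta d\<close> with \<open>d dvd n\<close>.\<close>

definition dlog :: "'a \<Rightarrow> nat"
  where "dlog x = (SOME k. x = g [^] k)"

lemma pow_dlog: "x \<in> carrier G \<Longrightarrow> g [^] dlog x = x"
  unfolding dlog_def using someI_ex[OF generated] by metis

definition character :: "nat \<Rightarrow> 'a \<Rightarrow> complex"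
  where "character d x = zeta d ^ dlog x"

lemma divisor_pos: "d dvd n \<Longrightarrow> d > 0"
  using n by (auto intro: Nat.gr0I)

lemma character_pow:
  assumes "d dvd n"
  shows "character d (g [^] k) = zeta d ^ k"
proof -
  have "dlog (g [^] k) mod n = k mod n"
    using pow_dlog[of "g [^] k"] g by (simp add: pow_eq_iff)
  moreover have "zeta d ^ n = 1"
    using zeta_power_eq_1_iff[OF divisor_pos[OF assms]] assms by simp
  ultimately show ?thesis
    unfolding character_def by (metis root_of_unity_power_mod)
qed

lemma character_mult:
  assumes "d dvd n" and "x \<in> carrier G" and "y \<in> carrier G"
  shows "character d (x \<otimes> y) = character d x * character d y"
proof -
  obtain k l where "x = g [^] (k::nat)" "y = g [^] (l::nat)"
    using generated assms by blast
  then show ?thesis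
    using g assms(1) by (simp add: nat_pow_mult character_pow power_add)
qed

lemma character_power:
  assumes "d dvd n" and "x \<in> carrier G"
  shows "character d (x [^] m) = character d x ^ m"
proof -
  obtain k where "x = g [^] (k::nat)"
    using generated assms by blast
  then show ?thesis
    using g assms(1) by (simp add: nat_pow_pow character_pow power_mult)
qed

definition evaluation :: "nat \<Rightarrow> ('a \<Rightarrow>\<^sub>0 rat) \<Rightarrow> complex"
  where "evaluation d = linear_functional (character d)"

text \<open>Represents \<alpha> as a polynomial in the generator, so that evaluations become
  polynomial values on which the field automorphisms are known.\<close>

definition dlog_poly :: "('a \<Rightarrow>\<^sub>0 rat) \<Rightarrow> rat poly"
  where "dlog_poly \<alpha> = (\<Sum>x\<in>Poly_Mapping.keys \<alpha>. Polynomial.monom (Poly_Mapping.lookup \<alpha> x) (dlog x))"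

lemma ev_dlog_poly:
  "rat.ev (dlog_poly \<alpha>) (zeta d ^ m) = linear_functional (\<lambda>x. character d x ^ m) \<alpha>"
  by (simp add: dlog_poly_def rat.ev_sum rat.ev_monom linear_functional_def character_def
      mult.commute flip: power_mult)

lemma evaluation_eq_ev: "evaluation d \<alpha> = rat.ev (dlog_poly \<alpha>) (zeta d)"
  using ev_dlog_poly[of \<alpha> d 1] by (simp add: evaluation_def)

lemma evaluation_in_carrier:
  assumes "d dvd n"
  shows "evaluation d \<alpha> \<in> carrier (cyclotomic_field d)"
  using carrier_cyclotomic_field[OF divisor_pos[OF assms]] by (simp add: evaluation_eq_ev)

text \<open>Equivariance: the automorphism turns \<open>character d x\<close> into its
  \<open>m\<close>-th power, which is the character of \<open>x [^] m\<close>.\<close>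

lemma cyclotomic_aut_evaluation:
  assumes d: "d dvd n" and m: "coprime m n" and \<alpha>: "Poly_Mapping.keys \<alpha> \<subseteq> carrier G"
    and \<sigma>: "\<And>x. x \<in> carrier G \<Longrightarrow> \<sigma> x = x [^] m"
  shows "cyclotomic_aut d m (evaluation d \<alpha>) = evaluation d (linear_extension \<sigma> \<alpha>)"
proof -
  have "coprime m d"
    using m d by (metis coprime_divisors dvd_refl)
  then have "cyclotomic_aut d m (evaluation d \<alpha>) = linear_functional (\<lambda>x. character d x ^ m) \<alpha>"
    unfolding evaluation_eq_ev
    using cyclotomic_aut_ev[OF divisor_pos[OF d]] by (simp add: ev_dlog_poly)
  also have "\<dots> = linear_functional (\<lambda>x. character d (\<sigma> x)) \<alpha>"
    unfolding linear_functional_def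
    using \<alpha> by (intro sum.cong refl) (auto simp: \<sigma> character_power[OF d])
  finally show ?thesis
    by (simp add: evaluation_def linear_functional_linear_extension)
qed

lemma bij_betw_pow: "bij_betw (\<lambda>k. g [^] k) {..<n} (carrier G)"
proof (rule bij_betw_imageI)
  show "inj_on (\<lambda>k. g [^] k) {..<n}"
    by (auto simp: inj_on_def pow_eq_iff)
  have "x \<in> (\<lambda>k. g [^] k) ` {..<n}" if x: "x \<in> carrier G" for x
  proof -
    obtain k :: nat where "x = g [^] k"
      using generated[OF x] by blast
    then have "x = g [^] (k mod n)"
      by (simp add: pow_eq_iff)
    then show ?thesis
      using n by (intro image_eqI[of _ _ "k mod n"]) auto
  qed
  then show "(\<lambda>k. g [^] k) ` {..<n} = carrier G"
    using g by auto
qed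

lemma evaluation_inject:
  assumes \<alpha>: "Poly_Mapping.keys \<alpha> \<subseteq> carrier G" and \<beta>: "Poly_Mapping.keys \<beta> \<subseteq> carrier G"
    and eq: "\<And>d. d dvd n \<Longrightarrow> evaluation d \<alpha> = evaluation d \<beta>"
  shows "\<alpha> = \<beta>"
proof (rule poly_mapping_eqI)
  fix x
  have fin: "finite (carrier G)"
    using bij_betw_finite[OF bij_betw_pow] by simp
  \<comment> \<open>Indexing the group by \<open>k < n\<close> turns an element into the
    coefficients of a polynomial of degree below \<open>n\<close>.\<close>
  have expand: "evaluation d \<gamma> = (\<Sum>k<n. of_rat (Poly_Mapping.lookup \<gamma> (g [^] k)) * zeta d ^ k)"
    if "d dvd n" "Poly_Mapping.keys \<gamma> \<subseteq> carrier G" for d \<gamma>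
    unfolding evaluation_def linear_functional_superset[OF fin that(2)]
    by (simp add: character_pow[OF that(1)] flip: sum.reindex_bij_betw[OF bij_betw_pow])
  have vanish: "Poly_Mapping.lookup \<alpha> (g [^] k) - Poly_Mapping.lookup \<beta> (g [^] k) = 0" if "k < n" for k
  proof (rule vanishing_at_divisors[OF n _ that])
    fix d assume d: "d dvd n"
    show "(\<Sum>k<n. of_rat (Poly_Mapping.lookup \<alpha> (g [^] k) - Poly_Mapping.lookup \<beta> (g [^] k)) * zeta d ^ k) = 0"
      using eq[OF d] by (simp add: expand[OF d \<alpha>] expand[OF d \<beta>] of_rat_diff left_diff_distrib sum_subtractf)
  qed
  show "Poly_Mapping.lookup \<alpha> x = Poly_Mapping.lookup \<beta> x"
  proof (cases "x \<in> carrier G")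
    case True
    then obtain k where "k < n" "x = g [^] k"
      using bij_betw_pow by (auto simp: bij_betw_def)
    then show ?thesis
      using vanish by simp
  next
    case False
    then show ?thesis
      using \<alpha> \<beta> by (metis in_keys_iff subsetD)
  qed
qed

lemma evaluation_surject:
  assumes "\<And>d. d dvd n \<Longrightarrow> x d \<in> carrier (cyclotomic_field d)"
  shows "\<exists>\<alpha>. Poly_Mapping.keys \<alpha> \<subseteq> carrier G \<and> (\<forall>d. d dvd n \<longrightarrow> evaluation d \<alpha> = x d)"
proof -
  obtain P where P: "\<And>d. d dvd n \<Longrightarrow> rat.ev P (zeta d) = x d"
    using simultaneous_interpolation[OF n assms] by blast
  \<comment> \<open>\<open>P\<close> may have degree \<open>n\<close> or more; terms falling on the
    same group element simply add up, and evaluation is linear.\<close>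
  define \<alpha> where "\<alpha> = (\<Sum>k\<le>degree P. Poly_Mapping.single (g [^] k) (coeff P k))"
  have "Poly_Mapping.keys \<alpha> \<subseteq> carrier G"
    unfolding \<alpha>_def using g
    by (intro order.trans[OF Poly_Mapping.keys_sum]) (auto split: if_splits)
  moreover have "evaluation d \<alpha> = x d" if d: "d dvd n" for d
  proof -
    have "evaluation d \<alpha> = (\<Sum>k\<le>degree P. of_rat (coeff P k) * zeta d ^ k)"
      by (simp add: evaluation_def \<alpha>_def linear_functional_sum linear_functional_single character_pow[OF d])
    also have "\<dots> = rat.ev (\<Sum>k\<le>degree P. Polynomial.monom (coeff P k) k) (zeta d)"
      by (simp add: rat.ev_sum rat.ev_monom)
    finally show ?thesis
      by (simp add: poly_as_sum_of_monoms P[OF d])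
  qed
  ultimately show ?thesis by blast
qed

section \<open>Automorphisms of the group and the isomorphism\<close>

lemma order_eq: "Coset.order G = n"
  unfolding Coset.order_def using bij_betw_same_card[OF bij_betw_pow] by simp

text \<open>The image of the generator fixes the exponent, and a preimage of the generator supplies
  its inverse modulo \<open>n\<close>.\<close>

lemma aut_exponent:
  assumes "\<sigma> \<in> auto G"
  shows "coprime (aut_exponent G \<sigma>) n" and "z \<in> carrier G \<Longrightarrow> \<sigma> z = z [^] aut_exponent G \<sigma>"
proof -
  have hom: "\<sigma> \<in> hom G G" and bij: "bij_betw \<sigma> (carrier G) (carrier G)"
    using assms by (auto simp: auto_def Bij_def)
  interpret \<sigma>: group_hom G G \<sigma>
    by unfold_locales (rule hom)
  have "\<sigma> g \<in> carrier G"
    using g by simp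
  \<comment> \<open>Taking \<open>m < n\<close> matches the normalisation in
    \<open>aut_exponent\<close> and makes the exponent unique.\<close>
  then obtain m where m: "m < n" "\<sigma> g = g [^] m"
    using bij_betw_pow by (auto simp: bij_betw_def)
  have \<sigma>: "\<sigma> z = z [^] m" if z: "z \<in> carrier G" for z
  proof -
    obtain k where "z = g [^] (k::nat)"
      using generated[OF z] by blast
    then show ?thesis
      using g by (simp add: \<sigma>.hom_nat_pow m(2) nat_pow_pow mult.commute)
  qed
  obtain w where w: "w \<in> carrier G" "\<sigma> w = g"
    using bij g by (metis bij_betw_imp_surj_on imageE)
  obtain k :: nat where "w = g [^] k"
    using generated[OF w(1)] by blast
  then have "\<sigma> (g [^] k) = g"
    using w(2) by simp
  then have "g [^] (k * m) = g [^] (1::nat)"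
    using g by (simp add: \<sigma> nat_pow_pow)
  then have "[m * k = 1] (mod n)"
    unfolding pow_eq_iff by (simp add: Cong.cong_def mult.commute)
  then have cop: "coprime m n"
    by (metis coprime_iff_invertible_nat One_nat_def)
  have "aut_exponent G \<sigma> = m"
    unfolding aut_exponent_def order_eq
  proof (rule the_equality)
    fix m'
    assume m': "m' < n \<and> coprime m' n \<and> (\<forall>z\<in>carrier G. \<sigma> z = z [^] m')"
    then have "g [^] m' = g [^] m"
      using g m by metis
    then show "m' = m"
      using m m' by (simp add: pow_eq_iff)
  qed (use m \<sigma> cop in auto)
  then show "coprime (aut_exponent G \<sigma>) n" and "z \<in> carrier G \<Longrightarrow> \<sigma> z = z [^] aut_exponent G \<sigma>"
    using cop \<sigma> by auto
qed

text \<open>The evaluations at all divisors form the isomorphism: equivariance sends invariant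
  elements to invariant tuples, and with injectivity it makes preimages of invariant tuples
  invariant.\<close>

lemma fixed_group_algebra_isomorphic:
  assumes H: "H \<subseteq> auto G"
  shows "algebra_isomorphic rat_field (fixed_group_algebra G H)
    (direct_sum_algebra {d. d dvd n} (fixed_cyclotomic_field G H))"
proof -
  let ?A = "fixed_group_algebra G H" and ?F = "fixed_cyclotomic_field G H" and ?D = "{d. d dvd n}"
  let ?B = "direct_sum_algebra ?D ?F"
  define \<Phi> where "\<Phi> \<alpha> = (\<lambda>d\<in>?D. evaluation d \<alpha>)" for \<alpha>
  have carrier_A: "\<alpha> \<in> carrier ?A \<longleftrightarrow> Poly_Mapping.keys \<alpha> \<subseteq> carrier G
      \<and> (\<forall>\<sigma>\<in>H. linear_extension \<sigma> \<alpha> = \<alpha>)" for \<alpha>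
    by (simp add: fixed_group_algebra_def group_algebra_def)
  have carrier_F: "x \<in> carrier (?F d) \<longleftrightarrow> x \<in> carrier (cyclotomic_field d)
      \<and> (\<forall>\<sigma>\<in>H. cyclotomic_aut d (aut_exponent G \<sigma>) x = x)" for d x
    by (simp add: fixed_cyclotomic_field_def)
  have aut: "cyclotomic_aut d (aut_exponent G \<sigma>) (evaluation d \<alpha>) = evaluation d (linear_extension \<sigma> \<alpha>)"
    if "\<sigma> \<in> H" "d dvd n" "Poly_Mapping.keys \<alpha> \<subseteq> carrier G" for \<sigma> d \<alpha>
    using cyclotomic_aut_evaluation[OF that(2) aut_exponent(1) that(3) aut_exponent(2)] H that(1) by blast
  have keys_aut: "Poly_Mapping.keys (linear_extension \<sigma> \<alpha>) \<subseteq> carrier G"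
    if "\<sigma> \<in> H" "Poly_Mapping.keys \<alpha> \<subseteq> carrier G" for \<sigma> \<alpha>
    using that H by (intro keys_linear_extension[OF that(2)]) (auto simp: auto_def hom_def)
  have \<Phi>_carrier: "\<Phi> \<alpha> \<in> carrier ?B" if "\<alpha> \<in> carrier ?A" for \<alpha>
    using that by (auto simp: direct_sum_algebra_def \<Phi>_def carrier_A carrier_F evaluation_in_carrier aut)
  have inj: "inj_on \<Phi> (carrier ?A)"
  proof (rule inj_onI)
    fix \<alpha> \<beta> assume "\<alpha> \<in> carrier ?A" "\<beta> \<in> carrier ?A" "\<Phi> \<alpha> = \<Phi> \<beta>"
    then show "\<alpha> = \<beta>"
      by (intro evaluation_inject) (auto simp: carrier_A \<Phi>_def restrict_def fun_eq_iff split: if_splits)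
  qed
  have surj: "x \<in> \<Phi> ` carrier ?A" if x: "x \<in> carrier ?B" for x
  proof -
    have xF: "x d \<in> carrier (?F d)" if "d dvd n" for d
      using x that by (auto simp: direct_sum_algebra_def)
    then obtain \<alpha> where \<alpha>: "Poly_Mapping.keys \<alpha> \<subseteq> carrier G" "\<And>d. d dvd n \<Longrightarrow> evaluation d \<alpha> = x d"
      using evaluation_surject[of x] by (auto simp: carrier_F)
    \<comment> \<open>\<alpha> is not yet known to be invariant, so injectivity is applied on the
      whole group algebra, where \<alpha> and its image have equal evaluations.\<close>
    have "linear_extension \<sigma> \<alpha> = \<alpha>" if \<sigma>: "\<sigma> \<in> H" for \<sigma>
    proof (rule evaluation_inject[OF keys_aut[OF \<sigma> \<alpha>(1)] \<alpha>(1)])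
      fix d assume d: "d dvd n"
      show "evaluation d (linear_extension \<sigma> \<alpha>) = evaluation d \<alpha>"
        using aut[OF \<sigma> d \<alpha>(1)] xF[OF d] \<sigma> by (simp add: \<alpha>(2)[OF d] carrier_F)
    qed
    then have "\<alpha> \<in> carrier ?A"
      by (simp add: carrier_A \<alpha>(1))
    moreover have "x = \<Phi> \<alpha>"
      using x \<alpha>(2) unfolding \<Phi>_def
      by (intro extensionalityI[of _ ?D]) (auto simp: direct_sum_algebra_def PiE_def)
    ultimately show ?thesis by blast
  qed
  have "\<Phi> \<in> ring_hom ?A ?B"
  proof (rule ring_hom_memI)
    fix \<alpha> \<beta> assume "\<alpha> \<in> carrier ?A" "\<beta> \<in> carrier ?A"
    then have "evaluation d (\<alpha> \<otimes>\<^bsub>group_algebra G\<^esub> \<beta>) = evaluation d \<alpha> * evaluation d \<beta>" if "d dvd n" for d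
      unfolding evaluation_def using character_mult[OF that]
      by (intro linear_functional_mult) (auto simp: carrier_A)
    then show "\<Phi> (\<alpha> \<otimes>\<^bsub>?A\<^esub> \<beta>) = \<Phi> \<alpha> \<otimes>\<^bsub>?B\<^esub> \<Phi> \<beta>"
      by (auto simp: \<Phi>_def fixed_group_algebra_def direct_sum_algebra_def fixed_cyclotomic_field_def
          cyclotomic_field_simps restrict_def)
    show "\<Phi> (\<alpha> \<oplus>\<^bsub>?A\<^esub> \<beta>) = \<Phi> \<alpha> \<oplus>\<^bsub>?B\<^esub> \<Phi> \<beta>"
      by (auto simp: \<Phi>_def fixed_group_algebra_def group_algebra_def direct_sum_algebra_def
          fixed_cyclotomic_field_def cyclotomic_field_simps evaluation_def linear_functional_add restrict_def)
  next
    have "evaluation d (Poly_Mapping.single \<one> 1) = 1" if "d dvd n" for d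
      using character_pow[OF that, of 0] by (simp add: evaluation_def linear_functional_single)
    then show "\<Phi> \<one>\<^bsub>?A\<^esub> = \<one>\<^bsub>?B\<^esub>"
      by (auto simp: \<Phi>_def fixed_group_algebra_def group_algebra_def direct_sum_algebra_def
          fixed_cyclotomic_field_def cyclotomic_field_simps restrict_def)
  qed (rule \<Phi>_carrier)
  then have "\<Phi> \<in> ring_iso ?A ?B"
    using inj surj \<Phi>_carrier by (auto simp: ring_iso_def bij_betw_def)
  moreover have "\<Phi> (q \<odot>\<^bsub>?A\<^esub> \<alpha>) = q \<odot>\<^bsub>?B\<^esub> \<Phi> \<alpha>" for q \<alpha>
  proof -
    have "q \<odot>\<^bsub>?A\<^esub> \<alpha> = q \<odot>\<^bsub>group_algebra G\<^esub> \<alpha>"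
      by (simp add: fixed_group_algebra_def)
    then show ?thesis
      by (auto simp: \<Phi>_def direct_sum_algebra_def fixed_cyclotomic_field_def cyclotomic_field_simps
          evaluation_def linear_functional_smult restrict_def)
  qed
  ultimately have "\<Phi> \<in> algebra_iso rat_field ?A ?B"
    by (simp add: algebra_iso_def)
  then show ?thesis
    by (auto simp: algebra_isomorphic_def)
qed

end

text \<open>\<open>cyclic_group\<close> provides integer powers of a generator; finiteness reduces
  them to natural powers and identifies the order of the generator with that of the group.\<close>

lemma (in group) finite_cyclic_groupI:
  assumes "cyclic_group G" and n: "Coset.order G > 0"
  shows "\<exists>g. finite_cyclic_group G g (Coset.order G)"
proof -
  obtain g where g: "g \<in> carrier G" and carr: "carrier G = range (\<lambda>k::int. g [^] k)"
    using assms(1) cyclic_group by blast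
  have fin: "finite (carrier G)"
    using n by (simp add: order_gt_0_iff_finite)
  have "generate G {g} = carrier G"
    using generate_pow[OF g] carr by auto
  then have gen: "carrier G = {g [^] k |k. k \<in> (UNIV :: nat set)}" and ord: "Coset.order G = ord g"
    using generate_pow_on_finite_carrier[OF fin g] generate_pow_card[OF g] by (auto simp: Coset.order_def)
  have "g [^] k = g [^] l \<longleftrightarrow> k mod ord g = l mod ord g" for k l :: nat
    using int_pow_eq[OF g, of "int k" "int l"]
    by (metis int_pow_int mod_eq_dvd_iff dvd_diff_commute zmod_int of_nat_eq_iff)
  then have "finite_cyclic_group G g (Coset.order G)"
    using g n gen by unfold_locales (auto simp: ord)
  then show ?thesis ..
qed

theorem theorem4p4:
  fixes G :: "('a, 'b) monoid_scheme" and n :: nat and H :: "('a \<Rightarrow> 'a) set"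
  assumes "group G"
    and "cyclic_group G"
    and "n > 0"
    and "Coset.order G = n"
    and "subgroup H (AutoGroup G)"
  shows "algebra_isomorphic rat_field
    (fixed_group_algebra G H)
    (direct_sum_algebra {d. d dvd n} (fixed_cyclotomic_field G H))"
proof -
  obtain g where "finite_cyclic_group G g n"
    using group.finite_cyclic_groupI[OF assms(1,2)] assms(3,4) by auto
  moreover have "H \<subseteq> auto G"
    using subgroup.subset[OF assms(5)] by (simp add: AutoGroup_def BijGroup_def)
  ultimately show ?thesis
    by (rule finite_cyclic_group.fixed_group_algebra_isomorphic)
qed

end
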